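(* For $n\in\mathbb{N}$, $n\ge 2$, let $\Psi_n(x)=\prod_{d\,\|\,n,\ d>1}\Phi_d(x)$. For every $n\in\mathbb{N}$, $n\ge2$, $$\prod_{\substack{k=1\\ k\text{ regular (mod }n)}}^{n-1}\sin\left(\frac{k\pi}{n}\right)=\frac{\Psi_n(1)}{2^{\varrho(n)-1}}=\frac{\kappa(n)}{2^{\varrho(n)-1}},$$ and for every odd $n\in\mathbb{N}$, $n\ge3$, $$\prod_{\substack{k=1\\ k\text{ regular (mod }n)}}^{n-1}\cos\left(\frac{k\pi}{n}\right)=\frac{\Psi_n(-1)}{(-4)^{(\varrho(n)-1)/2}}=\left(-\frac14\right)^{(\varrho(n)-1)/2}.$$
   Context: $\mathbb{N}=\{1,2,\ldots\}$. An integer $k$ is called regular (mod $n$) if there exists $y\in\mathbb{Z}$ with $k^2y\equiv k\pmod n$, and $\varrho(n)$ is the number of integers $k\in\{1,\ldots,n\}$ that are regular (mod $n$); $\varrho(n)$ is odd for every odd $n$, so the exponents $(\varrho(n)-1)/2$ in the second formula are integers. $d\,\|\,n$ means that $d$ is a unitary divisor of $n$, i.e. $d\ge1$, $d\mid n$ and $\gcd(d,n/d)=1$. $\Phi_n(x)=\prod_{1\le k\le n,\ \gcd(k,n)=1}(x-\exp(2\pi ik/n))$ is the $n$-th cyclotomic polynomial. $\kappa(n)=\prod_{p\mid n}p$ (product over primes) is the largest squarefree divisor of $n$. *)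

theory Defs
  imports
    "HOL-Analysis.Analysis"
    "HOL-Number_Theory.Number_Theory"
    "HOL-Computational_Algebra.Computational_Algebra"
begin

definition regular_mod :: "nat \<Rightarrow> int \<Rightarrow> bool" where
  "regular_mod n k \<longleftrightarrow> (\<exists>y::int. [k^2 * y = k] (mod int n))"

definition rho :: "nat \<Rightarrow> nat" where
  "rho n = card {k \<in> {1..n}. regular_mod n (int k)}"

definition unitary_dvd :: "nat \<Rightarrow> nat \<Rightarrow> bool" where
  "unitary_dvd d n \<longleftrightarrow> d \<ge> 1 \<and> d dvd n \<and> coprime d (n div d)"

definition cyclotomic :: "nat \<Rightarrow> complex poly" where
  "cyclotomic n =
     (\<Prod>k\<in>{k \<in> {1..n}. coprime k n}. [:- exp (2 * of_real pi * \<i> * of_nat k / of_nat n), 1:])"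

definition Psi :: "nat \<Rightarrow> complex poly" where
  "Psi n = (\<Prod>d\<in>{d. unitary_dvd d n \<and> d > 1}. cyclotomic d)"

definition kappa :: "nat \<Rightarrow> nat" where
  "kappa n = (\<Prod>p\<in>prime_factors n. p)"

lemma regular_mod_minus:
  assumes "regular_mod n k"
  shows "regular_mod n (int n - k)"
proof -
  from assms obtain y where y: "[k^2 * y = k] (mod int n)"
    unfolding regular_mod_def by blast
  have "[int n - k = - k] (mod int n)"
    by (simp add: cong_iff_dvd_diff)
  moreover from this have "[(int n - k)^2 * (- y) = (- k)^2 * (- y)] (mod int n)"
    by (intro cong_mult cong_pow cong_refl)
  moreover have "[(- k)^2 * (- y) = - k] (mod int n)"
    using y by (simp add: cong_minus_minus_iff)
  ultimately show ?thesis
    unfolding regular_mod_def by (meson cong_sym cong_trans)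
qed

text \<open>
  For odd \<open>n\<close> the quotient \<open>(rho n - 1) div 2\<close> is exact, and the truncated subtraction
  is harmless since \<open>rho n \<ge> 1\<close>.
\<close>
lemma odd_rho:
  assumes "odd n"
  shows "odd (rho n)"
proof -
  let ?L = "{k \<in> {1..n}. regular_mod n (int k) \<and> 2 * k < n}"
  have npos: "n > 0"
    using assms by (rule odd_pos)
  have regn: "regular_mod n (int n)"
    unfolding regular_mod_def by (intro exI[of _ 1]) (simp add: cong_iff_dvd_diff power2_eq_square)
  have refl: "regular_mod n (int (n - k))" if "regular_mod n (int k)" "k \<le> n" for k
    using regular_mod_minus[OF that(1)] that(2) by (simp add: of_nat_diff)
  have eq: "{k \<in> {1..n}. regular_mod n (int k)} = insert n (?L \<union> (\<lambda>k. n - k) ` ?L)"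
  proof (intro equalityI subsetI)
    fix k assume "k \<in> {k \<in> {1..n}. regular_mod n (int k)}"
    then have k: "1 \<le> k" "k \<le> n" "regular_mod n (int k)" by auto
    consider "k = n" | "2 * k < n" | "k < n" "2 * k > n"
      using k assms by (metis dvd_triv_left le_neq_implies_less linorder_neqE_nat)
    then show "k \<in> insert n (?L \<union> (\<lambda>k. n - k) ` ?L)"
    proof cases
      case 3
      then have "n - k \<in> ?L" "k = n - (n - k)"
        using k refl[OF k(3,2)] by auto
      then show ?thesis by blast
    qed (use k in auto)
  next
    fix k assume "k \<in> insert n (?L \<union> (\<lambda>k. n - k) ` ?L)"
    then show "k \<in> {k \<in> {1..n}. regular_mod n (int k)}"
      using regn npos refl by auto
  qed
  have "inj_on (\<lambda>k. n - k) ?L"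
    by (auto simp: inj_on_def)
  then have "card (?L \<union> (\<lambda>k. n - k) ` ?L) = 2 * card ?L"
    by (subst card_Un_disjoint) (auto simp: card_image)
  moreover have "n \<notin> ?L \<union> (\<lambda>k. n - k) ` ?L"
    by auto
  ultimately show ?thesis
    unfolding rho_def eq by (subst card_insert_disjoint) auto
qed

end

theory Submission
  imports Defs
begin

text \<open>
  An integer \<open>k\<close> in \<open>{1..n}\<close> is regular iff the denominator of \<open>k / n\<close> in lowest terms is a
  unitary divisor of \<open>n\<close>, so \<open>\<Psi>\<^sub>n\<close> is the product of \<open>x - exp (2 \<pi> i k / n)\<close> over the regular
  \<open>k < n\<close>. Up to phases, the factors are \<open>2 sin (k \<pi> / n)\<close> at \<open>x = 1\<close> and
  \<open>2 cos (k \<pi> / n)\<close> at \<open>x = -1\<close>. Removing the root 1 from \<open>x ^ n - 1\<close> gives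
  \<open>\<Prod>d | d dvd n \<and> d > 1. \<Phi>\<^sub>d(x) = \<Sum>i<n. x ^ i\<close>, which determines \<open>\<Phi>\<^sub>d(1) = exp (mangoldt d)\<close>
  and, for odd \<open>d\<close>, \<open>\<Phi>\<^sub>d(-1) = 1\<close>. The sign of the cosine product
  comes from pairing \<open>k\<close> with \<open>n - k\<close>.
\<close>

section \<open>Regular residues and fractions in lowest terms\<close>

lemma cyclotomic_cis:
  "cyclotomic d = (\<Prod>j\<in>{j \<in> {1..d}. coprime j d}. [:- cis (2 * pi * (real j / real d)), 1:])"
  unfolding cyclotomic_def
  by (intro prod.cong) (auto simp: cis_conv_exp mult_ac)

text \<open>Write k = g * a and n = g * b with g = gcd k n. Cancelling g, and then a, which is
  coprime to b, turns the congruence into k * y = 1 modulo b. This is solvable iff k, equivalently g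
  = n / b, is coprime to b.\<close>

lemma regular_mod_iff_unitary_dvd:
  assumes "k \<in> {1..n}"
  shows "regular_mod n (int k) \<longleftrightarrow> unitary_dvd (n div gcd k n) n"
proof -
  define g where "g = gcd k n"
  have g: "g > 0" using assms by (auto simp: g_def)
  define a b where "a = k div g" and "b = n div g"
  have ab: "k = g * a" "n = g * b" "coprime a b"
    using assms by (auto simp: g_def a_def b_def intro: div_gcd_coprime)
  have b: "b > 0" using assms ab by (cases b) auto
  have "[(int k)\<^sup>2 * y = int k] (mod int n) \<longleftrightarrow> [int k * y = 1] (mod int b)" for y
  proof -
    have "[(int k)\<^sup>2 * y = int k] (mod int n) \<longleftrightarrow>
        int g * int b dvd int g * (int a * (int k * y - 1))"
      by (simp add: cong_iff_dvd_diff ab power2_eq_square algebra_simps)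
    also have "\<dots> \<longleftrightarrow> int b dvd int a * (int k * y - 1)"
      using g by simp
    also have "\<dots> \<longleftrightarrow> int b dvd int k * y - 1"
      using ab(3) by (intro coprime_dvd_mult_right_iff) (simp add: coprime_commute)
    finally show ?thesis by (simp add: cong_iff_dvd_diff)
  qed
  hence "regular_mod n (int k) \<longleftrightarrow> coprime (int k) (int b)"
    unfolding regular_mod_def by (simp add: coprime_iff_invertible_int)
  also have "\<dots> \<longleftrightarrow> coprime g b"
    using ab by simp
  also have "\<dots> \<longleftrightarrow> unitary_dvd (n div gcd k n) n"
    unfolding unitary_dvd_def g_def[symmetric] using ab(2) g b
    by (auto simp: coprime_commute)
  finally show ?thesis .
qed

text \<open>Only k = n gives k / n the denominator 1, so excluding d = 1 from a product over
  denominators amounts to stopping at k = n - 1.\<close>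

lemma less_iff_denominator_gt_1:
  fixes k n :: nat
  assumes "1 \<le> k" "k \<le> n"
  shows "k < n \<longleftrightarrow> n div gcd k n > 1"
proof -
  have "gcd k n = n" if "n div gcd k n = 1"
    using that dvd_div_mult_self[of "gcd k n" n] by simp
  moreover have "n div gcd k n > 0"
    using assms by (simp add: div_greater_zero_iff dvd_imp_le)
  moreover have "gcd k n \<noteq> n" if "k < n"
    using that assms gcd_le1_nat[of k n] by linarith
  ultimately show ?thesis
    using assms by (cases "k = n"; cases "n div gcd k n = 1") auto
qed

text \<open>Each k / n is a unique reduced fraction j / d with d dividing n. The filter
  \<open>P\<close> is left general: unitary d > 1 yields \<open>Psi\<close>, while all d > 1 yield
  the geometric sum.\<close>

lemma prod_fractions_by_denominator:
  fixes f :: "real \<Rightarrow> 'a::comm_monoid_mult"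
  assumes "n > 0"
  shows "(\<Prod>k\<in>{k \<in> {1..n}. P (n div gcd k n)}. f (real k / real n)) =
         (\<Prod>d\<in>{d. d dvd n \<and> P d}. \<Prod>j\<in>{j \<in> {1..d}. coprime j d}. f (real j / real d))"
proof -
  let ?S = "{k \<in> {1..n}. P (n div gcd k n)}" and ?T = "{d. d dvd n \<and> P d}"
  have "(\<Prod>k\<in>?S. f (real k / real n)) =
      (\<Prod>d\<in>?T. \<Prod>k\<in>{k \<in> ?S. n div gcd k n = d}. f (real k / real n))"
    using assms by (intro prod.group[symmetric]) (auto simp: div_dvd_iff_mult)
  also have "\<dots> = (\<Prod>d\<in>?T. \<Prod>j\<in>{j \<in> {1..d}. coprime j d}. f (real j / real d))"
  proof (rule prod.cong[OF refl])
    fix d assume d: "d \<in> ?T"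
    then obtain c where c: "n = d * c" by auto
    have pos: "c > 0" "d > 0" using assms c by auto
    have gcd: "gcd (j * c) n = gcd j d * c" for j
      unfolding c by (metis gcd_mult_distrib_nat mult.commute)
    \<comment> \<open>Expanding j / d by c = n / d inverts reduction to lowest terms. As gcd (j * c)
      n = gcd j d * c, the reduced denominator is d exactly when j is coprime to d.\<close>
    have "bij_betw (\<lambda>j. j * c) {j \<in> {1..d}. coprime j d} {k \<in> ?S. n div gcd k n = d}"
    proof (rule bij_betw_imageI)
      show "inj_on (\<lambda>j. j * c) {j \<in> {1..d}. coprime j d}"
        using pos by (auto intro: inj_onI)
      show "(\<lambda>j. j * c) ` {j \<in> {1..d}. coprime j d} = {k \<in> ?S. n div gcd k n = d}"
      proof (intro equalityI subsetI)
        fix k assume "k \<in> (\<lambda>j. j * c) ` {j \<in> {1..d}. coprime j d}"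
        then obtain j where j: "k = j * c" "1 \<le> j" "j \<le> d" "coprime j d" by auto
        have "n div gcd k n = d" using j(4) pos by (simp add: j(1) gcd, simp add: c)
        moreover have "1 \<le> k" "k \<le> n" using j pos c by (auto simp: Suc_le_eq)
        ultimately show "k \<in> {k \<in> ?S. n div gcd k n = d}" using d by simp
      next
        fix k assume "k \<in> {k \<in> ?S. n div gcd k n = d}"
        hence k: "1 \<le> k" "k \<le> n" "n div gcd k n = d" by auto
        have "d * gcd k n = d * c" using k(3) c by (metis dvd_div_mult_self gcd_dvd2)
        hence g: "gcd k n = c" using pos by simp
        then obtain j where j: "k = j * c" by (metis dvdE gcd_dvd1 mult.commute)
        have "gcd j d * c = c" using g gcd[of j] j by simp
        hence "coprime j d" using pos by (intro gcd_eq_1_imp_coprime) simp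
        moreover have "j \<in> {1..d}" using k(1,2) pos c j by (cases "j = 0") auto
        ultimately show "k \<in> (\<lambda>j. j * c) ` {j \<in> {1..d}. coprime j d}" using j by auto
      qed
    qed
    from prod.reindex_bij_betw[OF this, of "\<lambda>k. f (real k / real n)"]
    show "(\<Prod>k\<in>{k \<in> ?S. n div gcd k n = d}. f (real k / real n)) =
      (\<Prod>j\<in>{j \<in> {1..d}. coprime j d}. f (real j / real d))"
      using pos by (simp add: c)
  qed
  finally show ?thesis .
qed

section \<open>Products over roots of unity\<close>

lemma geometric_sum_eq_prod_roots:
  assumes "n > 0"
  shows "(\<Sum>i<n. x ^ i) = (\<Prod>k\<in>{1..<n}. x - cis (2 * pi * (real k / real n)))"
proof -
  let ?r = "\<lambda>k. cis (2 * pi * real k / real n)"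
  let ?p = "\<Sum>i<n. Polynomial.monom (1::complex) i" and ?q = "\<Prod>k\<in>{1..<n}. [:- ?r k, 1:]"
  have inj: "inj_on ?r {..<n}"
    using Complex.bij_betw_roots_unity[OF assms] by (simp add: bij_betw_def)
  have poly: "poly ?p x = (\<Sum>i<n. x ^ i)" "poly ?q x = (\<Prod>k\<in>{1..<n}. x - ?r k)" for x
    by (simp_all add: poly_sum poly_monom poly_prod)
  have coeff_p: "poly.coeff ?p i = (if i < n then 1 else 0)" for i
    by (simp add: coeff_sum)
  have deg_p: "degree ?p = n - 1"
    using assms by (intro antisym degree_le le_degree) (auto simp: coeff_p)
  have deg_q: "degree ?q = n - 1"
    by (subst degree_prod_eq_sum_degree) auto
  have "?p = ?q"
  \<comment> \<open>Both polynomials are monic of degree n - 1, so their difference has smaller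
    degree and agreement at the n - 1 nontrivial roots of unity suffices.\<close>
  proof (rule poly_eqI_degree_lead_coeff[where A = "?r ` {1..<n}" and n = "n - 1"])
    have "lead_coeff ?q = 1" by (simp add: lead_coeff_prod)
    thus "poly.coeff ?p (n - 1) = poly.coeff ?q (n - 1)"
      using assms deg_q by (simp add: coeff_p)
    show "card (?r ` {1..<n}) \<ge> n - 1"
      by (subst card_image) (auto intro: inj_on_subset[OF inj])
    fix z assume "z \<in> ?r ` {1..<n}"
    then obtain k where k: "z = ?r k" "k \<in> {1..<n}" by auto
    have "z ^ n = 1" 
      using Complex.bij_betw_roots_unity[OF assms] k by (auto simp: bij_betw_def)
    moreover have "z \<noteq> 1" 
      using inj_onD[OF inj, of k 0] k by auto
    ultimately have "poly ?p z = 0"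
      by (simp add: poly geometric_sum)
    moreover have "poly ?q z = 0"
      unfolding poly(2) using k by (intro prod_zero) auto
    ultimately show "poly ?p z = poly ?q z" by simp
  qed (simp_all only: deg_p deg_q order_refl)
  thus ?thesis using poly[of x] by simp
qed

lemma poly_Psi:
  assumes "n \<ge> 2"
  shows "poly (Psi n) x =
    (\<Prod>k\<in>{k \<in> {1..n - 1}. regular_mod n (int k)}. x - cis (2 * pi * (real k / real n)))"
proof -
  have "{k \<in> {1..n - 1}. regular_mod n (int k)} =
      {k \<in> {1..n}. unitary_dvd (n div gcd k n) n \<and> n div gcd k n > 1}"
    using assms
    by (auto simp: regular_mod_iff_unitary_dvd less_iff_denominator_gt_1[symmetric] simp del: One_nat_def)
  moreover have "{d. d dvd n \<and> unitary_dvd d n \<and> d > 1} = {d. unitary_dvd d n \<and> d > 1}"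
    by (auto simp: unitary_dvd_def)
  ultimately show ?thesis
    using prod_fractions_by_denominator[where n = n and P = "\<lambda>d. unitary_dvd d n \<and> d > 1" and f = "\<lambda>t. x - cis (2 * pi * t)"] assms
    by (simp add: Psi_def cyclotomic_cis poly_prod)
qed

section \<open>Values of cyclotomic polynomials at 1 and -1\<close>

lemma prod_cyclotomic:
  assumes "n > 0"
  shows "(\<Prod>d\<in>{d. d dvd n \<and> d > 1}. poly (cyclotomic d) x) = (\<Sum>i<n. x ^ i)"
proof -
  have "{1..<n} = {k \<in> {1..n}. n div gcd k n > 1}"
    by (auto simp: less_iff_denominator_gt_1[symmetric] simp del: One_nat_def)
  thus ?thesis
    using prod_fractions_by_denominator[where n = n and P = "\<lambda>d. d > 1" and f = "\<lambda>t. x - cis (2 * pi * t)"] assms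
    by (simp add: geometric_sum_eq_prod_roots cyclotomic_cis poly_prod)
qed

text \<open>This stands in for multiplicative Moebius inversion. By strong induction f and g agree
  on the proper divisors, whose nonzero product then cancels from the identity for n itself.\<close>

lemma divisor_prod_unique:
  fixes f g :: "nat \<Rightarrow> 'a::field"
  assumes "\<And>d. d dvd n \<Longrightarrow> d > 1 \<Longrightarrow>
      (\<Prod>e\<in>{e. e dvd d \<and> e > 1}. f e) = (\<Prod>e\<in>{e. e dvd d \<and> e > 1}. g e)"
    and "\<And>d. d dvd n \<Longrightarrow> d > 1 \<Longrightarrow> g d \<noteq> 0" and "n > 1"
  shows "f n = g n"
  using assms
proof (induction n rule: less_induct)
  case (less n)
  let ?D = "{e. e dvd n \<and> e > 1}"
  have fin: "finite (?D - {n})" and n: "n \<in> ?D"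
    using less.prems by (auto intro: finite_subset[OF _ finite_divisors_nat[of n]])
  have eq: "(\<Prod>e\<in>?D - {n}. f e) = (\<Prod>e\<in>?D - {n}. g e)"
  proof (rule prod.cong[OF refl])
    fix e assume e: "e \<in> ?D - {n}"
    hence "e < n" using less.prems(3) by (auto dest!: dvd_imp_le)
    thus "f e = g e" using e less.prems by (intro less.IH) (auto intro: dvd_trans)
  qed
  have "f n * (\<Prod>e\<in>?D - {n}. f e) = g n * (\<Prod>e\<in>?D - {n}. g e)"
    using less.prems(1)[of n] less.prems(3) n fin
    by (simp add: prod.remove[of ?D n] del: One_nat_def)
  moreover have "(\<Prod>e\<in>?D - {n}. g e) \<noteq> 0"
    using fin less.prems(2) by simp
  ultimately show ?case using eq by simp
qed

lemma cyclotomic_at_1: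
  assumes "n > 1"
  shows "poly (cyclotomic n) 1 = of_real (exp (mangoldt n))"
proof (rule divisor_prod_unique[OF _ _ assms])
  fix d assume d: "d dvd n" "d > 1"
  \<comment> \<open>The divisor e = 1 may be added because \<open>mangoldt 1\<close> is 0. The sum
    of \<open>mangoldt\<close> over all divisors of d is ln d, which matches the value d of the
    geometric sum at 1.\<close>
  have "(\<Prod>e\<in>{e. e dvd d \<and> e > 1}. exp (mangoldt e :: real)) = (\<Prod>e | e dvd d. exp (mangoldt e))"
    using d by (intro prod.mono_neutral_left) (auto simp: mangoldt_def dest: primepow_gt_Suc_0)
  also have "\<dots> = exp (\<Sum>e | e dvd d. mangoldt e)"
    using d by (simp add: exp_sum)
  also have "\<dots> = real d"
    using d by (simp add: mangoldt_sum)
  finally show "(\<Prod>e\<in>{e. e dvd d \<and> e > 1}. poly (cyclotomic e) 1) =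
      (\<Prod>e\<in>{e. e dvd d \<and> e > 1}. complex_of_real (exp (mangoldt e)))"
    using d prod_cyclotomic[of d 1] by (simp flip: of_real_prod)
qed auto

lemma cyclotomic_at_minus_1:
  assumes "n > 1" "odd n"
  shows "poly (cyclotomic n) (-1) = 1"
proof (rule divisor_prod_unique[where f = "\<lambda>n. poly (cyclotomic n) (-1)" and g = "\<lambda>_. 1", OF _ _ assms(1)])
  fix d assume d: "d dvd n" "d > 1"
  hence "odd d" using assms by auto
  \<comment> \<open>An alternating sum with an odd number of terms is 1, so the constant function 1
    satisfies the same divisor product identities.\<close>
  hence "(\<Sum>i<d. (-1) ^ i :: complex) = 1" by (simp add: geometric_sum)
  thus "(\<Prod>e\<in>{e. e dvd d \<and> e > 1}. poly (cyclotomic e) (-1)) = (\<Prod>e\<in>{e. e dvd d \<and> e > 1}. 1)"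
    using d prod_cyclotomic[of d "-1"] by simp
qed auto

section \<open>Values of \<open>Psi\<close> at 1 and -1\<close>

lemma Psi_at_1:
  assumes "n \<ge> 2"
  shows "poly (Psi n) 1 = of_nat (kappa n)"
proof -
  let ?U = "{d. unitary_dvd d n \<and> d > 1}"
  have fin: "finite ?U"
    using assms by (auto simp: unitary_dvd_def intro: finite_subset[OF _ finite_divisors_nat[of n]])
  \<comment> \<open>Only prime powers contribute a factor other than 1. A prime power dividing n is
    unitary only if it is the full power of p in n, which leaves one d for each prime
    factor.\<close>
  have sub: "{d \<in> ?U. primepow d} = (\<lambda>p. p ^ multiplicity p n) ` prime_factors n"
  proof (intro equalityI subsetI)
    fix d assume "d \<in> {d \<in> ?U. primepow d}"
    then obtain p k c where d: "prime p" "k > 0" "d = p ^ k" "n = d * c" "coprime d c"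
      using assms by (auto simp: unitary_dvd_def primepow_def elim!: dvdE)
    hence "\<not> p dvd c" using coprime_common_divisor[of d c p] by (auto dest: not_prime_unit)
    hence "multiplicity p n = k"
      using d by (intro multiplicity_eqI) auto
    moreover have "p \<in> prime_factors n" using d(1-4) assms by (auto simp: in_prime_factors_iff dvd_power intro!: Nat.gr0I)
    ultimately show "d \<in> (\<lambda>p. p ^ multiplicity p n) ` prime_factors n" using d(3) by (intro image_eqI[of _ _ p]) simp_all
  next
    fix d assume "d \<in> (\<lambda>p. p ^ multiplicity p n) ` prime_factors n"
    then obtain p where p: "p \<in> prime_factors n" "d = p ^ multiplicity p n" by auto
    obtain c where c: "n = d * c" "\<not> p dvd c"
      using multiplicity_decompose'[of n p] p assms
      by (metis in_prime_factors_iff not_prime_unit)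
    have pos: "multiplicity p n > 0" using p by (simp add: prime_factors_multiplicity)
    have "primepow d" using p pos by (auto simp: primepow_def)
    moreover have "coprime d c" using p c(2) by (auto intro!: prime_imp_coprime)
    ultimately show "d \<in> {d \<in> ?U. primepow d}"
      using c(1) assms primepow_gt_Suc_0[of d] by (auto simp: unitary_dvd_def)
  qed
  \<comment> \<open>Each full prime power contributes p. Recovering p by
    \<open>aprimedivisor\<close> gives the injectivity needed to reindex by primes.\<close>
  have val: "exp (mangoldt (p ^ multiplicity p n)) = real p"
    "aprimedivisor (p ^ multiplicity p n) = p" if "p \<in> prime_factors n" for p
    using that by (auto simp: prime_factors_multiplicity aprimedivisor_prime_power prime_gt_0_nat)
  have "poly (Psi n) 1 = of_real (\<Prod>d\<in>?U. exp (mangoldt d))"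
    by (simp add: Psi_def poly_prod cyclotomic_at_1)
  also have "(\<Prod>d\<in>?U. exp (mangoldt d)) = (\<Prod>d\<in>{d \<in> ?U. primepow d}. exp (mangoldt d :: real))"
    by (intro prod.mono_neutral_right fin) (auto simp: mangoldt_def)
  also have "\<dots> = (\<Prod>p\<in>prime_factors n. exp (mangoldt (p ^ multiplicity p n)))"
    unfolding sub by (rule prod.reindex_cong[OF inj_on_inverseI[of _ aprimedivisor]]) (auto simp: val)
  also have "\<dots> = real (kappa n)"
    by (simp add: val kappa_def)
  finally show ?thesis by simp
qed

lemma Psi_at_minus_1:
  assumes "odd n"
  shows "poly (Psi n) (-1) = 1"
  unfolding Psi_def poly_prod using assms
  by (intro prod.neutral) (auto simp: unitary_dvd_def intro!: cyclotomic_at_minus_1)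

section \<open>From roots of unity to sines and cosines\<close>

lemma card_regular:
  assumes "n \<ge> 2"
  shows "card {k \<in> {1..n - 1}. regular_mod n (int k)} = rho n - 1"
proof -
  \<comment> \<open>The residue n is counted by \<open>rho\<close> but absent from the products,
    hence the exponent \<open>rho n - 1\<close>.\<close>
  have "regular_mod n (int n)"
    unfolding regular_mod_def by (intro exI[of _ 1]) (simp add: cong_iff_dvd_diff power2_eq_square)
  hence "{k \<in> {1..n}. regular_mod n (int k)} = insert n {k \<in> {1..n - 1}. regular_mod n (int k)}"
    using assms by auto
  moreover have "n \<notin> {k \<in> {1..n - 1}. regular_mod n (int k)}"
    using assms by auto
  ultimately show ?thesis by (simp add: rho_def del: One_nat_def)
qed

lemma norm_1_minus_cis: "norm (1 - cis (2 * t)) = 2 * \<bar>sin t\<bar>"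
proof -
  have "1 - cis (2 * t) = - 2 * \<i> * of_real (sin t) * cis t"
    by (simp add: complex_eq_iff cos_double_sin sin_double power2_eq_square)
  thus ?thesis by (simp add: norm_mult)
qed

lemma minus_1_minus_cis: "- 1 - cis (2 * t) = - 2 * of_real (cos t) * cis t"
  by (simp add: complex_eq_iff cos_double_cos sin_double power2_eq_square)

lemma prod_sin_regular:
  assumes "n \<ge> 2"
  shows "(\<Prod>k\<in>{k \<in> {1..n - 1}. regular_mod n (int k)}. sin (real k * pi / real n)) =
    kappa n / 2 ^ (rho n - 1)"
proof -
  let ?S = "{k \<in> {1..n - 1}. regular_mod n (int k)}"
  have "real (kappa n) = norm (poly (Psi n) 1)"
    using Psi_at_1[OF assms] by simp
  also have "\<dots> = (\<Prod>k\<in>?S. 2 * sin (real k * pi / real n))"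
    unfolding poly_Psi[OF assms] prod_norm[symmetric]
  proof (rule prod.cong[OF refl])
    fix k assume k: "k \<in> ?S"
    hence "k < n" using assms by auto
    \<comment> \<open>The angle lies strictly between 0 and pi, so taking norms loses no
      sign.\<close>
    hence "sin (real k * pi / real n) > 0"
      using k by (intro sin_gt_zero) (auto simp: field_simps)
    thus "norm (1 - cis (2 * pi * (real k / real n))) = 2 * sin (real k * pi / real n)"
      using norm_1_minus_cis[of "real k * pi / real n"] by (simp add: mult_ac)
  qed
  finally show ?thesis
    unfolding prod.distrib prod_constant card_regular[OF assms] by simp
qed

lemma prod_cos_regular:
  assumes "n \<ge> 3" "odd n"
  shows "(\<Prod>k\<in>{k \<in> {1..n - 1}. regular_mod n (int k)}. cos (real k * pi / real n)) =
    (- (1 / 4)) ^ ((rho n - 1) div 2)"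
proof -
  let ?S = "{k \<in> {1..n - 1}. regular_mod n (int k)}"
  let ?L = "{k \<in> {1..n - 1}. regular_mod n (int k) \<and> 2 * k < n}"
    and ?R = "{k \<in> {1..n - 1}. regular_mod n (int k) \<and> 2 * k > n}"
  let ?c = "\<lambda>k. cos (real k * pi / real n)"
  define m where "m = (rho n - 1) div 2"
  have n2: "n \<ge> 2" using assms by simp
  have reg: "regular_mod n (int (n - k))" if "regular_mod n (int k)" "k \<le> n" for k
    using regular_mod_minus[OF that(1)] that(2) by (simp add: of_nat_diff)
  \<comment> \<open>For odd n the reflection k to n - k has no fixed point and swaps the lower and
    upper halves of the regular residues.\<close>
  have bij: "bij_betw (\<lambda>k. n - k) ?L ?R"
    by (rule bij_betw_byWitness[where f' = "\<lambda>k. n - k"]) (auto intro!: reg)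
  have "2 * k \<noteq> n" for k using assms by auto
  hence S: "?S = ?L \<union> ?R" by (auto simp: neq_iff)
  have "card ?S = card ?L + card ?R"
    unfolding S by (rule card_Un_disjoint) auto
  hence "rho n - 1 = 2 * card ?L"
    using bij_betw_same_card[OF bij] card_regular[OF n2] by simp
  hence m: "m = card ?L" "rho n - 1 = 2 * m" by (auto simp: m_def)
  have "(\<Prod>k\<in>?R. ?c k) = (\<Prod>k\<in>?L. ?c (n - k))"
    by (rule prod.reindex_bij_betw[OF bij, symmetric])
  also have "\<dots> = (\<Prod>k\<in>?L. - ?c k)"
  proof (rule prod.cong[OF refl])
    fix k assume "k \<in> ?L"
    hence "real (n - k) * pi / real n = pi - real k * pi / real n"
      using assms by (auto simp: field_simps of_nat_diff)
    thus "?c (n - k) = - ?c k" by simp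
  qed
  finally have "(\<Prod>k\<in>?S. ?c k) = (\<Prod>k\<in>?L. ?c k) * (\<Prod>k\<in>?L. - ?c k)"
    unfolding S by (subst prod.union_disjoint) auto
  \<comment> \<open>The reflection negates each of the m cosines of the lower half. The remaining
    square is nonnegative, so the sign of the whole product is that of (-1) ^ m.\<close>
  also have "\<dots> = (-1) ^ m * (\<Prod>k\<in>?L. ?c k)\<^sup>2"
    by (simp add: m(1) prod_uminus power2_eq_square)
  finally have sign: "(\<Prod>k\<in>?S. ?c k) = (-1) ^ m * \<bar>\<Prod>k\<in>?S. ?c k\<bar>"
    by (simp add: abs_mult)
  \<comment> \<open>The modulus comes from \<open>Psi\<close> at -1: the 2 * m factors 2 combine to
    4 ^ m.\<close>
  have "1 = norm (poly (Psi n) (-1))"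
    using Psi_at_minus_1[OF assms(2)] by simp
  also have "\<dots> = (\<Prod>k\<in>?S. 2 * \<bar>?c k\<bar>)"
    unfolding poly_Psi[OF n2] prod_norm[symmetric]
  proof (rule prod.cong[OF refl])
    fix k
    show "norm (- 1 - cis (2 * pi * (real k / real n))) = 2 * \<bar>?c k\<bar>"
      using minus_1_minus_cis[of "real k * pi / real n"] by (simp add: mult_ac norm_mult)
  qed
  also have "\<dots> = 4 ^ m * \<bar>\<Prod>k\<in>?S. ?c k\<bar>"
    unfolding prod.distrib prod_constant card_regular[OF n2] m(2) by (simp add: power_mult abs_prod)
  finally have "\<bar>\<Prod>k\<in>?S. ?c k\<bar> = (1 / 4) ^ m" by (simp add: field_simps)
  thus ?thesis using sign unfolding m_def[symmetric]
    by (simp flip: power_mult_distrib)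
qed

theorem proposition5p7p2:
  shows
    "(\<forall>n::nat. n \<ge> 2 \<longrightarrow>
        complex_of_real (\<Prod>k\<in>{k \<in> {1..n - 1}. regular_mod n (int k)}. sin (real k * pi / real n))
          = poly (Psi n) 1 / 2 ^ (rho n - 1)
        \<and> poly (Psi n) 1 / 2 ^ (rho n - 1) = of_nat (kappa n) / 2 ^ (rho n - 1))
   \<and> (\<forall>n::nat. n \<ge> 3 \<and> odd n \<longrightarrow>
        complex_of_real (\<Prod>k\<in>{k \<in> {1..n - 1}. regular_mod n (int k)}. cos (real k * pi / real n))
          = poly (Psi n) (- 1) / (- 4) ^ ((rho n - 1) div 2)
        \<and> poly (Psi n) (- 1) / (- 4) ^ ((rho n - 1) div 2) = (- (1 / 4)) ^ ((rho n - 1) div 2))"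
proof -
  have "1 / (- 4) ^ m = (- (1 / 4) :: complex) ^ m" for m
    by (simp add: field_simps flip: power_mult_distrib)
  thus ?thesis
    by (simp add: prod_sin_regular prod_cos_regular Psi_at_1 Psi_at_minus_1
      del: atLeastAtMost_iff One_nat_def of_real_prod)
qed

end
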